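(* Let $(\mathcal Q,d)$ be a Hadamard space, let $Y$ be a $\mathcal Q$-valued random variable concentrated on a separable set, let $m$ be a Fréchet median of $Y$, and let $m_n$ be an empirical Fréchet median of $n\in\mathbb N$ independent copies $Y_1,\dots,Y_n$ of $Y$. Let $r\in[0,\infty)$ be such that $\rho:=\mathbf P(d(Y,m)\le r)>\frac23$. Then $$\mathbf P\Big(d(m,m_n)>\tfrac{11}3\,r\Big)\le\Big(\tfrac{27}4(1-\rho)\rho^2\Big)^{\frac n3}\le\Big(2(1-\rho)^{\frac13}\Big)^n.$$
   Context: A Hadamard space is a nonempty complete metric space $(\mathcal Q,d)$ such that for all $y_0,y_1\in\mathcal Q$ there is $p\in\mathcal Q$ with $\frac12 d(y_0,q)^2+\frac12 d(y_1,q)^2-\frac14 d(y_0,y_1)^2\ge d(q,p)^2$ for all $q\in\mathcal Q$; it carries its Borel $\sigma$-algebra. "Concentrated on a separable set" means $\mathbf P(Y\in\mathcal Y)=1$ for some separable $\mathcal Y\subset\mathcal Q$. A Fréchet median of $Y$ is any $m\in\arg\min_{q\in\mathcal Q}\mathbf E[d(Y,q)-d(Y,o)]$ with an arbitrary reference point $o\in\mathcal Q$ (independent of $o$; no moment condition needed). $m_n\in\arg\min_{q\in\mathcal Q}\sum_{j=1}^n d(Y_j,q)$ is a measurable function of $(Y_1,\dots,Y_n)$. *)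

theory Defs
  imports "HOL-Probability.Probability"
begin

class hadamard_space = complete_space +
  assumes hadamard_inequality:
    "\<exists>p. \<forall>q. (dist p q)\<^sup>2
       \<le> (dist y\<^sub>0 q)\<^sup>2 / 2 + (dist y\<^sub>1 q)\<^sup>2 / 2 - (dist y\<^sub>0 y\<^sub>1)\<^sup>2 / 4"

text \<open>
  The integrand is bounded by the distance from \<open>q\<close> to the reference point \<open>c\<close> and
  continuous in \<open>Y\<close>, so the expectation exists for every random variable \<open>Y\<close> on a
  probability space, without any moment condition.
\<close>

definition frechet_median ::
    "'w measure \<Rightarrow> ('w \<Rightarrow> 'a::metric_space) \<Rightarrow> 'a \<Rightarrow> 'a \<Rightarrow> bool" where
  "frechet_median M Y c m \<longleftrightarrow>
     is_arg_min (\<lambda>q. \<integral>\<omega>. (dist (Y \<omega>) q - dist (Y \<omega>) c) \<partial>M) (\<lambda>_. True) m"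

definition empirical_frechet_median :: "nat \<Rightarrow> (nat \<Rightarrow> 'a::metric_space) \<Rightarrow> 'a \<Rightarrow> bool" where
  "empirical_frechet_median n y m \<longleftrightarrow>
     is_arg_min (\<lambda>q. \<Sum>j=1..n. dist (y j) q) (\<lambda>_. True) m"

end

theory Submission
  imports Defs
begin

text \<open>
  The bound holds because two thirds of the sample already pin the median down: if strictly
  more than two thirds of the points \<open>y\<^sub>j\<close> lie within \<open>r\<close> of \<open>m\<close>, every
  empirical median \<open>q\<close> satisfies \<open>dist m q \<le> 2 * r\<close>
  (\<open>empirical_frechet_median_near\<close>). To see this, compare \<open>q\<close> with the midpoint \<open>p\<close>
  of \<open>m\<close> and \<open>q\<close>, and put \<open>D = dist m q\<close>. Moving from \<open>q\<close> to \<open>p\<close> brings every point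
  near \<open>m\<close> closer by at least \<open>D / 4\<close> if \<open>D\<close> exceeds \<open>2 * r\<close>, by the Hadamard
  inequality, whereas any other point moves away by at most \<open>D / 2\<close>, by the triangle inequality.
  With more than twice as many near points as far ones the sum of distances decreases strictly,
  which contradicts minimality of \<open>q\<close>.

  Since \<open>2 * r \<le> 11/3 * r\<close>, the event in question therefore forces at least one third of the
  sample to be farther than \<open>r\<close> from \<open>m\<close>, each point being so independently with
  probability \<open>1 - \<rho> < 1/3\<close>. The Chernoff bound for binomial tails
  (\<open>binomial_tail_chernoff\<close>) at level \<open>1/3\<close> is exactly
  \<open>(27/4 * (1 - \<rho>) * \<rho>\<^sup>2) powr (n / 3)\<close>. The second inequality follows from \<open>27/4 * \<rho>\<^sup>2 \<le> 8\<close>.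
\<close>

text \<open>
  The decrease \<open>D / 4\<close> is half the length of the step from \<open>q\<close> to \<open>p\<close>: after squaring, the claim
  is a quadratic inequality in \<open>b = dist y q\<close> that is increasing for \<open>b \<ge> D / 2\<close>, and
  \<open>b \<ge> D - r \<ge> D / 2\<close>. At \<open>b = D - r\<close> it reads \<open>5 * D\<^sup>2 / 16 \<ge> r * D / 2\<close>.
\<close>

lemma midpoint_decreases_dist_to_near_point:
  fixes y m q p :: "'a::metric_space"
  assumes mid: "(dist p y)\<^sup>2 \<le> (dist m y)\<^sup>2 / 2 + (dist q y)\<^sup>2 / 2 - (dist m q)\<^sup>2 / 4"
    and near: "dist y m \<le> r" and far: "2 * r \<le> dist m q"
  shows "dist y p \<le> dist y q - dist m q / 4"
proof -
  define D b where "D = dist m q" and "b = dist y q"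
  have r0: "0 \<le> r" using near zero_le_dist[of y m] by linarith
  have b: "D - r \<le> b"
    using dist_triangle[of m q y] near by (simp add: D_def b_def dist_commute)
  have D: "2 * r \<le> D" using far by (simp add: D_def)
  have "(dist y m)\<^sup>2 \<le> r\<^sup>2" using near by (intro power_mono) auto
  then have "(dist y p)\<^sup>2 \<le> r\<^sup>2 / 2 + b\<^sup>2 / 2 - D\<^sup>2 / 4"
    using mid by (simp add: D_def b_def dist_commute)
  also have "\<dots> \<le> (b - D / 4)\<^sup>2"
  proof -
    have "0 \<le> (b - (D - r)) * (b - r)"
      using b D by (intro mult_nonneg_nonneg) auto
    moreover have "0 \<le> D * (5 * D - 8 * r)"
      using D r0 by (intro mult_nonneg_nonneg) auto
    ultimately show ?thesis
      by (simp add: power2_eq_square field_simps)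
  qed
  finally have "dist y p \<le> b - D / 4"
    using b D r0 by (intro power2_le_imp_le[of "dist y p"]) auto
  then show ?thesis by (simp add: D_def b_def)
qed

lemma empirical_frechet_median_near:
  fixes y :: "nat \<Rightarrow> 'a::hadamard_space"
  assumes med: "empirical_frechet_median n y q"
    and maj: "3 * card {j \<in> {1..n}. \<not> dist (y j) m \<le> r} < n"
    and r: "0 \<le> r"
  shows "dist m q \<le> 2 * r"
proof (rule ccontr)
  assume "\<not> dist m q \<le> 2 * r"
  then have D: "2 * r \<le> dist m q" "0 < dist m q" using r by auto
  obtain p where p: "\<And>x. (dist p x)\<^sup>2
      \<le> (dist m x)\<^sup>2 / 2 + (dist q x)\<^sup>2 / 2 - (dist m q)\<^sup>2 / 4"
    using hadamard_inequality[of m q] by auto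
  have "(dist p q)\<^sup>2 \<le> (dist m q / 2)\<^sup>2"
    using p[of q] by (simp add: power2_eq_square)
  then have pq: "dist p q \<le> dist m q / 2" by (rule power2_le_imp_le) simp
  define F where "F = {j \<in> {1..n}. \<not> dist (y j) m \<le> r}"
  \<comment> \<open>The step changes the distance to a far point by at most \<open>D / 2\<close> and to a near one by
    at most \<open>- D / 4\<close>, where \<open>D = dist m q\<close>; the bounds
    differ by \<open>3/4 * D\<close>, hence the single indicator.\<close>
  have change: "dist (y j) p
      \<le> dist (y j) q + dist m q * (3/4 * indicator F j - 1/4)" if "j \<in> {1..n}" for j
  proof (cases "j \<in> F")
    case True
    then show ?thesis
      using dist_triangle[of "y j" p q] pq by (simp add: dist_commute)
  next
    case False
    then have "dist (y j) m \<le> r" using that by (simp add: F_def)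
    from midpoint_decreases_dist_to_near_point[OF p this D(1)] False show ?thesis by simp
  qed
  have card: "(\<Sum>j=1..n. indicator F j) = real (card F)"
    by (simp add: F_def indicator_def sum.If_cases Int_def)
  have "(\<Sum>j=1..n. dist (y j) p)
      \<le> (\<Sum>j=1..n. dist (y j) q + dist m q * (3/4 * indicator F j - 1/4))"
    by (intro sum_mono change)
  also have "\<dots> = (\<Sum>j=1..n. dist (y j) q) + dist m q * (3/4 * card F - n / 4)"
    unfolding sum.distrib sum_distrib_left[symmetric] sum_subtractf card by simp
  also have "\<dots> < (\<Sum>j=1..n. dist (y j) q)"
    using maj D(2) by (simp add: F_def mult_less_0_iff)
  finally show False
    using med by (auto simp: empirical_frechet_median_def is_arg_min_def)
qed

text \<open>
  The number \<open>K\<close> of successes has exponential moment \<open>E (s ^ K) = (1 - p + s * p) ^ n\<close>, and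
  Markov's inequality gives \<open>P (K \<ge> a * n) \<le> (1 - p + s * p) ^ n / s powr (a * n)\<close> for every
  \<open>s \<ge> 1\<close>. The bound stated is the one for the optimal \<open>s\<close>; it is the usual
  \<open>exp (- n * KL(a, p))\<close>, where \<open>KL\<close> is the relative entropy of the Bernoulli laws, written
  without logarithms so that it also covers \<open>p = 0\<close>.
\<close>

lemma (in prob_space) binomial_tail_chernoff:
  fixes X :: "'i \<Rightarrow> 'a \<Rightarrow> 'b"
  assumes I: "finite I" and ind: "indep_vars N X I"
    and S: "\<And>i. i \<in> I \<Longrightarrow> S i \<in> sets (N i)"
    and p: "\<And>i. i \<in> I \<Longrightarrow> prob {\<omega> \<in> space M. X i \<omega> \<in> S i} = p"
    and p0: "0 \<le> p" and pa: "p \<le> a" and a: "0 < a" "a < 1"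
  shows "prob {\<omega> \<in> space M. a * card I \<le> card {i \<in> I. X i \<omega> \<in> S i}}
    \<le> ((p / a) powr a * ((1 - p) / (1 - a)) powr (1 - a)) ^ card I"
    (is "prob ?E \<le> _")
proof -
  define n where "n = card I"
  have X[measurable]: "\<And>i. i \<in> I \<Longrightarrow> X i \<in> M \<rightarrow>\<^sub>M N i"
    using ind by (auto simp: indep_vars_def)
  note S[measurable]
  define K where "K = (\<lambda>\<omega>. card {i \<in> I. X i \<omega> \<in> S i})"
  show ?thesis
  proof (cases "p = 0")
    case True
    \<comment> \<open>The optimal \<open>s\<close> would be infinite, but almost surely there is no success.\<close>
    show ?thesis
    proof (cases "n = 0")
      case False
      have "AE \<omega> in M. \<forall>i\<in>I. X i \<omega> \<notin> S i"
        using I p True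
        by (intro AE_finite_allI)
           (auto intro!: AE_I[where N = "{\<omega> \<in> space M. X i \<omega> \<in> S i}" for i]
              simp: emeasure_eq_measure)
      then have "AE \<omega> in M. \<omega> \<in> ?E \<longrightarrow> \<omega> \<in> {}"
      proof eventually_elim
        case (elim \<omega>)
        then have none: "{i \<in> I. X i \<omega> \<in> S i} = {}" by auto
        show ?case using a False by (simp add: none n_def mult_le_0_iff)
      qed
      then have "prob ?E \<le> prob {}" by (rule finite_measure_mono_AE) simp
      then show ?thesis using True False by (simp add: n_def zero_power)
    qed (simp add: n_def)
  next
    case False
    then have p1: "0 < p" "p < 1" using p0 pa a by auto
    \<comment> \<open>This \<open>s\<close> minimises \<open>(1 - p + s * p) / s powr a\<close>; it is at least \<open>1\<close> because \<open>p \<le> a\<close>.\<close>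
    define s where "s = a * (1 - p) / (p * (1 - a))"
    have s1: "1 \<le> s" using p1 a pa by (simp add: s_def field_simps)
    have mean: "expectation (\<lambda>\<omega>. if X i \<omega> \<in> S i then s else 1) = (1 - p) / (1 - a)"
      if i: "i \<in> I" for i
    proof -
      have [measurable]: "{\<omega> \<in> space M. X i \<omega> \<in> S i} \<in> events"
        using i by measurable
      have "expectation (\<lambda>\<omega>. if X i \<omega> \<in> S i then s else 1)
          = expectation (\<lambda>\<omega>. 1 + (s - 1) * indicator {\<omega> \<in> space M. X i \<omega> \<in> S i} \<omega>)"
        by (intro Bochner_Integration.integral_cong) auto
      also have "\<dots> = 1 + (s - 1) * p"
        by (subst Bochner_Integration.integral_add)
           (auto simp: prob_space p[OF i] Int_absorb1 emeasure_eq_measure)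
      also have "\<dots> = (1 - p) / (1 - a)"
        using p1 a by (simp add: s_def field_simps)
      finally show ?thesis .
    qed
    have int: "integrable M (\<lambda>\<omega>. if X i \<omega> \<in> S i then s else 1)" if i: "i \<in> I" for i
    proof (rule integrable_const_bound[where B = s])
      show "(\<lambda>\<omega>. if X i \<omega> \<in> S i then s else 1) \<in> borel_measurable M"
        using i by measurable
    qed (use s1 in auto)
    have ind': "indep_vars (\<lambda>_. borel) (\<lambda>i \<omega>. if X i \<omega> \<in> S i then s else 1) I"
      by (rule indep_vars_compose2[OF ind, where Y = "\<lambda>i x. if x \<in> S i then s else 1"])
         measurable
    have pow: "(\<Prod>i\<in>I. if X i \<omega> \<in> S i then s else 1) = s ^ K \<omega>" for \<omega>
      using I by (simp add: K_def prod.If_cases Int_def)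
    have moment: "expectation (\<lambda>\<omega>. s ^ K \<omega>) = ((1 - p) / (1 - a)) ^ n"
      using indep_vars_lebesgue_integral[OF I ind' int] mean by (simp add: pow n_def)
    have int': "integrable M (\<lambda>\<omega>. s ^ K \<omega>)"
      using indep_vars_integrable[OF I ind' int] by (simp add: pow)
    have "prob ?E \<le> prob {\<omega> \<in> space M. s powr (a * n) \<le> s ^ K \<omega>}"
      using s1 int' by (intro finite_measure_mono)
        (auto simp: K_def n_def powr_realpow[symmetric] intro!: powr_mono)
    also have "\<dots> \<le> expectation (\<lambda>\<omega>. s ^ K \<omega>) / s powr (a * n)"
      using s1 by (intro integral_Markov_inequality_measure[OF int', where A = "space M", simplified]) auto
    also have "\<dots> = (s powr (- a) * ((1 - p) / (1 - a))) ^ n"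
      using s1 by (simp add: moment powr_minus powr_powr[symmetric] powr_realpow
            power_mult_distrib power_divide power_inverse divide_inverse ac_simps)
    also have "s powr (- a) * ((1 - p) / (1 - a))
        = (p / a) powr a * ((1 - p) / (1 - a)) powr (1 - a)"
    proof -
      define u v where "u = (1 - p) / (1 - a)" and "v = p / a"
      have uv: "0 < u" "0 < v" using p1 a by (auto simp: u_def v_def)
      have "s = u / v" by (simp add: s_def u_def v_def mult.commute)
      then have "s powr (- a) * u = v powr a * u powr (1 - a)"
        using uv by (simp add: powr_minus powr_divide powr_diff)
      then show ?thesis by (simp only: u_def v_def)
    qed
    finally show ?thesis by (simp add: n_def)
  qed
qed

theorem corollary4p12:
  fixes M :: "'w measure"
    and Y :: "'w \<Rightarrow> 'a::hadamard_space"
    and Ys :: "nat \<Rightarrow> 'w \<Rightarrow> 'a"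
    and c m :: 'a
    and n :: nat
    and mn :: "(nat \<Rightarrow> 'a) \<Rightarrow> 'a"
    and r \<rho> :: real
  assumes "prob_space M"
    and "Y \<in> measurable M borel"
    and "\<exists>S. separable_space (top_of_set S) \<and> measure M {\<omega> \<in> space M. Y \<omega> \<in> S} = 1"
    and "frechet_median M Y c m"
    and "n \<ge> 1"
    and "prob_space.indep_vars M (\<lambda>_. borel) Ys {1..n}"
    and "\<And>j. j \<in> {1..n} \<Longrightarrow> distr M borel (Ys j) = distr M borel Y"
    and "mn \<in> measurable (\<Pi>\<^sub>M j\<in>{1..n}. borel) borel"
    and "AE \<omega> in M. empirical_frechet_median n (\<lambda>j. Ys j \<omega>) (mn (\<lambda>j\<in>{1..n}. Ys j \<omega>))"
    and "r \<ge> 0"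
    and "\<rho> = measure M {\<omega> \<in> space M. dist (Y \<omega>) m \<le> r}"
    and "\<rho> > 2/3"
  shows "measure M {\<omega> \<in> space M. dist m (mn (\<lambda>j\<in>{1..n}. Ys j \<omega>)) > 11/3 * r}
           \<le> (27/4 * (1 - \<rho>) * \<rho>\<^sup>2) powr (real n / 3)
      \<and> (27/4 * (1 - \<rho>) * \<rho>\<^sup>2) powr (real n / 3) \<le> (2 * (1 - \<rho>) powr (1/3)) ^ n"
proof -
  interpret prob_space M by fact
  define x where "x = 27/4 * (1 - \<rho>) * \<rho>\<^sup>2"
  have \<rho>: "2/3 < \<rho>" "\<rho> \<le> 1" using assms(11,12) by auto
  have x0: "0 \<le> x" using \<rho> by (simp add: x_def)
  \<comment> \<open>At \<open>x = 0\<close> the left side is \<open>0\<close> and the right side is \<open>0 ^ n\<close>, so \<open>n \<ge> 1\<close> matters here.\<close>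
  have root: "x powr (real n / 3) = (x powr (1/3)) ^ n"
    using \<open>n \<ge> 1\<close> by (cases "x = 0") (simp_all add: powr_power)
  have Ys[measurable]: "Ys j \<in> M \<rightarrow>\<^sub>M borel" if "j \<in> {1..n}" for j
    using assms(6) that by (auto simp: indep_vars_def)
  define S where "S = {y::'a. \<not> dist y m \<le> r}"
  have S[measurable]: "S \<in> sets borel"
    unfolding S_def not_le by (intro borel_open open_Collect_less continuous_intros)
  have far: "prob {\<omega> \<in> space M. Ys j \<omega> \<in> S} = 1 - \<rho>" if j: "j \<in> {1..n}" for j
  proof -
    have "prob {\<omega> \<in> space M. Ys j \<omega> \<in> S} = measure (distr M borel (Ys j)) S"
      using j by (simp add: measure_distr vimage_def Int_def conj_commute)
    also have "\<dots> = prob {\<omega> \<in> space M. Y \<omega> \<in> S}"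
      using assms(2) by (simp add: assms(7)[OF j] measure_distr vimage_def Int_def conj_commute)
    also have "\<dots> = 1 - \<rho>"
    proof -
      have "{\<omega> \<in> space M. Y \<omega> \<in> S} \<in> events" using assms(2) by measurable
      from prob_compl[OF this] show ?thesis
        by (simp add: assms(11) S_def set_diff_eq cong: conj_cong)
    qed
    finally show ?thesis .
  qed
  let ?E = "{\<omega> \<in> space M. 1/3 * card {1..n} \<le> card {j \<in> {1..n}. Ys j \<omega> \<in> S}}"
  have "?E \<in> events" by measurable
  moreover have "AE \<omega> in M. \<omega> \<in> {\<omega> \<in> space M.
      dist m (mn (\<lambda>j\<in>{1..n}. Ys j \<omega>)) > 11/3 * r} \<longrightarrow> \<omega> \<in> ?E"
    using assms(9)
  proof eventually_elim
    case (elim \<omega>)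
    show ?case
    proof safe
      assume *: "11/3 * r < dist m (mn (\<lambda>j\<in>{1..n}. Ys j \<omega>))"
      show "1/3 * card {1..n} \<le> card {j \<in> {1..n}. Ys j \<omega> \<in> S}"
      proof (rule ccontr)
        assume "\<not> ?thesis"
        then have "3 * card {j \<in> {1..n}. \<not> dist (Ys j \<omega>) m \<le> r} < n"
          by (simp add: S_def)
        from empirical_frechet_median_near[OF elim this \<open>r \<ge> 0\<close>] * \<open>r \<ge> 0\<close>
        show False by simp
      qed
    qed
  qed
  ultimately have "prob {\<omega> \<in> space M. dist m (mn (\<lambda>j\<in>{1..n}. Ys j \<omega>)) > 11/3 * r}
      \<le> prob ?E"
    by (intro finite_measure_mono_AE)
  also have "\<dots> \<le> (((1 - \<rho>) / (1/3)) powr (1/3)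
      * ((1 - (1 - \<rho>)) / (1 - 1/3)) powr (1 - 1/3)) ^ card {1..n}"
    using \<rho> S far by (intro binomial_tail_chernoff[OF _ assms(6)]) auto
  also have "((1 - \<rho>) / (1/3)) powr (1/3) * ((1 - (1 - \<rho>)) / (1 - 1/3)) powr (1 - 1/3)
      = x powr (1/3)"
  proof -
    have "((1 - (1 - \<rho>)) / (1 - 1/3)) powr (1 - 1/3) = ((3/2 * \<rho>)\<^sup>2) powr (1/3)"
      using \<rho> by (simp add: powr_powr mult.commute flip: powr_numeral)
    then show ?thesis
      using \<rho> by (simp add: x_def power2_eq_square algebra_simps flip: powr_mult)
  qed
  finally have "prob {\<omega> \<in> space M. dist m (mn (\<lambda>j\<in>{1..n}. Ys j \<omega>)) > 11/3 * r}
      \<le> x powr (real n / 3)" by (simp only: root card_atLeastAtMost diff_Suc_1)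
  moreover have "x powr (real n / 3) \<le> (2 * (1 - \<rho>) powr (1/3)) ^ n"
  proof -
    have "\<rho>\<^sup>2 \<le> 1" using \<rho> by (simp add: power_le_one)
    then have "x \<le> 2 ^ 3 * (1 - \<rho>)"
      using mult_left_mono[of "27/4 * \<rho>\<^sup>2" 8 "1 - \<rho>"] \<rho> by (simp add: x_def algebra_simps)
    then have "x powr (1/3) \<le> (2 ^ 3 * (1 - \<rho>)) powr (1/3)"
      using x0 by (intro powr_mono2) auto
    also have "\<dots> = (2 ^ 3) powr (1/3) * (1 - \<rho>) powr (1/3)"
      by (rule powr_mult)
    also have "(2 ^ 3) powr (1/3) = (2::real)"
      by (simp only: powr_powr flip: powr_numeral) simp
    finally show ?thesis unfolding root by (rule power_mono) simp
  qed
  ultimately show ?thesis by (simp add: x_def)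
qed

end
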